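(* Let $R$ be a commutative ring with identity containing $\mathbb{Q}$ and let $N\ge2$ be an integer. For every $N\times N$ matrix $A$ with entries in $R$ such that $A^\top A=I_N$, and every $p\in R[X_1,\ldots,X_N]$, $$\lambda_0\bigl(p(XA)\bigr)=\lambda_0\bigl(p(X)\bigr).$$
   Context: $X=(X_1,\ldots,X_N)$ and $XA$ is the $N$-tuple with $k$-th component $(XA)_k=\sum_{m=1}^NX_mA_{mk}$; $p(XA)$ is the polynomial obtained by substituting $(XA)_k$ for $X_k$ in $p$. $\partial_j=\partial/\partial X_j$ and $M_{jk}=X_j\partial_k-X_k\partial_j$ for distinct $j,k\in\{1,\ldots,N\}$. $\lambda_0\colon R[X_1,\ldots,X_N]\to R$ denotes the unique $R$-linear map such that $\lambda_0\circ M_{jk}=0$ for all $j\ne k$ and $\lambda_0\bigl((X_1^2+\cdots+X_N^2)^n\bigr)=1$ for all integers $n\ge0$ (it exists and is unique). *)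

theory Defs
  imports "HOL-Analysis.Analysis" "HOL-Library.Poly_Mapping"
begin

text \<open>
  The variables are indexed by a finite type \<open>'n\<close>, so that \<open>N = CARD('n)\<close>; a monomial is its
  exponent vector.
\<close>

type_synonym ('n, 'r) mpoly = "('n \<Rightarrow>\<^sub>0 nat) \<Rightarrow>\<^sub>0 'r"

definition mconst :: "'r::zero \<Rightarrow> ('n, 'r) mpoly"
  where "mconst c = Poly_Mapping.single 0 c"

definition mvar :: "'n \<Rightarrow> ('n, 'r::zero_neq_one) mpoly"
  where "mvar j = Poly_Mapping.single (Poly_Mapping.single j 1) 1"

definition mscale :: "'r::comm_ring_1 \<Rightarrow> ('n, 'r) mpoly \<Rightarrow> ('n, 'r) mpoly"
  where "mscale c p = mconst c * p"

definition msubst :: "('n::finite \<Rightarrow> ('n, 'r) mpoly) \<Rightarrow> ('n, 'r::comm_ring_1) mpoly \<Rightarrow> ('n, 'r) mpoly"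
  where "msubst Y p =
    (\<Sum>m\<in>Poly_Mapping.keys p.
      mconst (Poly_Mapping.lookup p m) * (\<Prod>k\<in>UNIV. Y k ^ Poly_Mapping.lookup m k))"

text \<open>
  Subtraction of exponents truncates at 0; the monomials without \<open>X\<^sub>j\<close> still contribute 0
  because of the factor \<open>of_nat 0\<close>.
\<close>

definition mpderiv :: "'n \<Rightarrow> ('n, 'r::comm_ring_1) mpoly \<Rightarrow> ('n, 'r) mpoly"
  where "mpderiv j p =
    (\<Sum>m\<in>Poly_Mapping.keys p.
      Poly_Mapping.single (m - Poly_Mapping.single j 1)
        (of_nat (Poly_Mapping.lookup m j) * Poly_Mapping.lookup p m))"

definition M_op :: "'n \<Rightarrow> 'n \<Rightarrow> ('n, 'r::comm_ring_1) mpoly \<Rightarrow> ('n, 'r) mpoly"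
  where "M_op j k p = mvar j * mpderiv k p - mvar k * mpderiv j p"

definition is_lambda0 :: "(('n::finite, 'r::comm_ring_1) mpoly \<Rightarrow> 'r) \<Rightarrow> bool"
  where "is_lambda0 L \<longleftrightarrow>
    module_hom mscale (*) L \<and>
    (\<forall>j k p. j \<noteq> k \<longrightarrow> L (M_op j k p) = 0) \<and>
    (\<forall>n::nat. L ((\<Sum>j\<in>UNIV. mvar j ^ 2) ^ n) = 1)"

text \<open>
  The description is proper only under the standing assumptions that the coefficient ring contains
  the rationals and that there are at least two variables.
\<close>

definition lambda0 :: "('n::finite, 'r::comm_ring_1) mpoly \<Rightarrow> 'r"
  where "lambda0 = (THE L. is_lambda0 L)"

definition contains_rat :: "'r::comm_ring_1 itself \<Rightarrow> bool"
  where "contains_rat _ \<longleftrightarrow>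
    (\<exists>\<iota> :: rat \<Rightarrow> 'r. inj \<iota> \<and> \<iota> 1 = 1 \<and>
      (\<forall>x y. \<iota> (x + y) = \<iota> x + \<iota> y) \<and> (\<forall>x y. \<iota> (x * y) = \<iota> x * \<iota> y))"

definition XA :: "('r::comm_ring_1) ^ 'n ^ 'n \<Rightarrow> 'n::finite \<Rightarrow> ('n, 'r) mpoly"
  where "XA A k = (\<Sum>m\<in>UNIV. mvar m * mconst (A $ m $ k))"

end

theory Submission
  imports Defs
begin

text \<open>
  Write \<open>S = X\<^sub>1\<^sup>2 + \<dots> + X\<^sub>N\<^sup>2\<close>. For a monomial \<open>q\<close> of degree \<open>d\<close>, summing \<open>M\<^sub>j\<^sub>k (X\<^sub>k q)\<close> over \<open>k\<close>
  gives \<open>(N - 1 + d) X\<^sub>j q - S \<partial>\<^sub>j q\<close> by Euler's identity, and the operators \<open>M\<^sub>j\<^sub>k\<close> commute with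
  multiplication by \<open>S\<close>; this recursion determines every normalised functional that kills the
  images of the \<open>M\<^sub>j\<^sub>k\<close>, by induction on the degree. The moments of the uniform measure on the
  sphere provide such a functional. If \<open>A\<close> is orthogonal then substituting \<open>XA\<close> fixes \<open>S\<close> and turns
  the operators \<open>M\<^sub>j\<^sub>k\<close> into linear combinations of each other, so \<open>p \<mapsto> \<lambda>\<^sub>0 (p(XA))\<close> is again
  normalised and equals \<open>\<lambda>\<^sub>0\<close> by uniqueness. That \<open>S\<close> is fixed needs \<open>A A\<^sup>T = I\<close>, which follows from
  \<open>A\<^sup>T A = I\<close> over any commutative ring by means of the adjugate.
\<close>

abbreviation lookup where "lookup \<equiv> Poly_Mapping.lookup"
abbreviation keys where "keys \<equiv> Poly_Mapping.keys"
abbreviation single where "single \<equiv> Poly_Mapping.single"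

subsection \<open>Polynomials\<close>

text \<open>The zero polynomial falls under \<open>single\<close> with coefficient 0, so additive
  statements need checking on terms only.\<close>

lemma poly_mapping_induct_single [case_names single add]:
  fixes p :: "'a \<Rightarrow>\<^sub>0 'b::comm_monoid_add"
  assumes "\<And>m c. P (single m c)" and "\<And>p q. P p \<Longrightarrow> P q \<Longrightarrow> P (p + q)"
  shows "P p"
proof -
  have "P (\<Sum>m\<in>S. single m (lookup p m))" if "finite S" for S
    using that
  proof induction
    case empty
    then show ?case using assms(1)[of undefined 0] by simp
  qed (simp add: assms)
  moreover have "p = (\<Sum>m\<in>keys p. single m (lookup p m))"
    by (rule poly_mapping_eqI) (auto simp: lookup_sum lookup_single when_def in_keys_iff)
  ultimately show ?thesis by (metis finite_keys)
qed

lemma mconst_0 [simp]: "mconst 0 = 0"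
  and mconst_1 [simp]: "mconst 1 = 1"
  and mconst_add: "mconst (a + b) = mconst a + mconst b"
  and mconst_mult: "mconst (a * b) = mconst a * mconst b"
  for a b :: "'r::comm_ring_1"
  by (simp_all add: mconst_def single_add mult_single)

lemma mconst_of_nat: "mconst (of_nat n :: 'r::comm_ring_1) = of_nat n"
  by (simp add: mconst_def)

lemma mconst_sum: "mconst (sum f S) = (\<Sum>x\<in>S. mconst (f x))"
  for f :: "'a \<Rightarrow> 'r::comm_ring_1"
  by (induction S rule: infinite_finite_induct) (simp_all add: mconst_add)

lemma mconst_mult_single: "mconst c * single m d = single m (c * d)"
  for c d :: "'r::comm_ring_1"
  by (simp add: mconst_def mult_single)

lemma single_eq_mconst_mult: "single m c = mconst c * single m 1"
  for c :: "'r::comm_ring_1"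
  by (simp add: mconst_mult_single)

lemma mvar_mult_single: "mvar j * single m c = single (single j 1 + m) c"
  for c :: "'r::comm_ring_1"
  by (simp add: mvar_def mult_single)

lemma mvar_power: "mvar j ^ n = single (single j n) (1 :: 'r::comm_ring_1)"
proof (induction n)
  case (Suc n)
  then show ?case by (simp add: mvar_def mult_single flip: single_add)
qed simp

lemma single_eq_prod_mvar:
  fixes m :: "'n::finite \<Rightarrow>\<^sub>0 nat" and c :: "'r::comm_ring_1"
  shows "single m c = mconst c * (\<Prod>k\<in>UNIV. mvar k ^ lookup m k)"
proof -
  have "(\<Prod>k\<in>S. mvar k ^ lookup m k) = single (\<Sum>k\<in>S. single k (lookup m k)) (1::'r)"
    if "finite S" for S
    using that by induction (simp_all add: mvar_power mult_single)
  moreover have "(\<Sum>k\<in>UNIV. single k (lookup m k)) = m"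
    by (rule poly_mapping_eqI) (simp add: lookup_sum lookup_single when_def)
  ultimately show ?thesis
    by (simp add: mconst_mult_single)
qed

text \<open>Terms are products of constants and variables. This form suits statements compatible
  with products, such as the chain rule.\<close>

lemma mpoly_induct [case_names const var add mult]:
  fixes p :: "('n::finite, 'r::comm_ring_1) mpoly"
  assumes const: "\<And>c. P (mconst c)" and var: "\<And>j. P (mvar j)"
    and add: "\<And>p q. P p \<Longrightarrow> P q \<Longrightarrow> P (p + q)"
    and mult: "\<And>p q. P p \<Longrightarrow> P q \<Longrightarrow> P (p * q)"
  shows "P p"
proof (induction p rule: poly_mapping_induct_single)
  case (single m c)
  have one: "P 1" using const[of 1] by simp
  have pow: "P (mvar j ^ n)" for j n by (induction n) (simp_all add: one var mult)
  have "P (\<Prod>k\<in>S. mvar k ^ lookup m k)" if "finite S" for S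
    using that by induction (simp_all add: one pow mult)
  then show ?case by (simp add: single_eq_prod_mvar const mult)
qed (rule add)

section \<open>Substitution as a ring homomorphism\<close>

lemma msubst_single:
  "msubst Y (single m c) = mconst c * (\<Prod>k\<in>UNIV. Y k ^ lookup m k)"
  by (simp add: msubst_def)

text \<open>Keys may cancel in \<open>p + q\<close>; this is harmless because each summand is
  additive in its coefficient and vanishes at coefficient 0.\<close>

lemma msubst_add: "msubst Y (p + q) = msubst Y p + msubst Y q"
  unfolding msubst_def
  by (rule setsum_keys_plus_distrib) (simp_all add: mconst_add distrib_right)

lemma msubst_mult: "msubst Y (p * q) = msubst Y p * msubst Y q"
proof (induction p rule: poly_mapping_induct_single)
  case (single m c)
  show ?case
  proof (induction q rule: poly_mapping_induct_single)
    case (single l d)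
    show ?case
      by (simp add: mult_single msubst_single lookup_add power_add prod.distrib mconst_mult)
  qed (simp add: distrib_left msubst_add)
qed (simp add: distrib_right msubst_add)

lemma msubst_mconst [simp]: "msubst Y (mconst c) = mconst c"
  by (simp add: mconst_def msubst_single)

lemma msubst_0 [simp]: "msubst Y 0 = 0" and msubst_1 [simp]: "msubst Y 1 = 1"
  using msubst_mconst[of Y 0] msubst_mconst[of Y 1] by simp_all

lemma msubst_mvar [simp]: "msubst Y (mvar j) = Y j"
proof -
  have "(\<Prod>k\<in>UNIV. Y k ^ lookup (single j 1) k) = (\<Prod>k\<in>UNIV. if k = j then Y k else 1)"
    by (rule prod.cong) (auto simp: lookup_single)
  then show ?thesis by (simp add: mvar_def msubst_single)
qed

lemma msubst_diff: "msubst Y (p - q) = msubst Y p - msubst Y q"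
  using msubst_add[of Y "p - q" q] by simp

lemma msubst_sum: "msubst Y (sum f S) = (\<Sum>x\<in>S. msubst Y (f x))"
  by (induction S rule: infinite_finite_induct) (simp_all add: msubst_add)

lemma msubst_power: "msubst Y (p ^ n) = msubst Y p ^ n"
  by (induction n) (simp_all add: msubst_mult)

section \<open>Partial derivatives and the chain rule\<close>

lemma mpderiv_single:
  "mpderiv j (single m c) = single (m - single j 1) (of_nat (lookup m j) * c)"
  by (simp add: mpderiv_def)

lemma mpderiv_add: "mpderiv j (p + q) = mpderiv j p + mpderiv j q"
  unfolding mpderiv_def
  by (rule setsum_keys_plus_distrib) (simp_all add: single_add distrib_left)

lemma mpderiv_mult: "mpderiv j (p * q) = mpderiv j p * q + p * mpderiv j q"
proof (induction p rule: poly_mapping_induct_single)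
  case (single m c)
  show ?case
  proof (induction q rule: poly_mapping_induct_single)
    case (single l d)
    \<comment> \<open>Truncated subtraction commutes with adding \<open>b\<close> when
      \<open>j\<close> has positive exponent in \<open>a\<close>; in the other case a factor
      \<open>of_nat 0\<close> makes the terms vanish.\<close>
    have *: "a - single j 1 + b = a + b - single j 1" if "lookup a j \<noteq> 0"
      for a b :: "'a \<Rightarrow>\<^sub>0 nat"
      using that by (intro poly_mapping_eqI) (auto simp: lookup_add lookup_minus lookup_single when_def)
    have 1: "single (m - single j 1 + l) (of_nat (lookup m j) * c * d)
        = single (m + l - single j 1) (of_nat (lookup m j) * c * d)"
      using *[of m l] by (cases "lookup m j = 0") simp_all
    have 2: "single (m + (l - single j 1)) (c * (of_nat (lookup l j) * d))
        = single (m + l - single j 1) (c * (of_nat (lookup l j) * d))"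
      using *[of l m] by (cases "lookup l j = 0") (simp_all add: add.commute)
    show ?case
      by (simp only: mult_single mpderiv_single 1 2)
        (simp add: lookup_add algebra_simps flip: single_add)
  qed (simp add: distrib_left mpderiv_add algebra_simps)
qed (simp add: distrib_right mpderiv_add algebra_simps)

lemma mpderiv_mconst [simp]: "mpderiv j (mconst c) = 0"
  by (simp add: mconst_def mpderiv_single)

lemma mpderiv_0 [simp]: "mpderiv j 0 = 0" and mpderiv_1 [simp]: "mpderiv j 1 = 0"
  using mpderiv_mconst[of j 0] mpderiv_mconst[of j 1] by (simp_all del: mpderiv_mconst)

lemma mpderiv_mvar: "mpderiv j (mvar k) = (if j = k then 1 else 0)"
  by (simp add: mvar_def mpderiv_single lookup_single when_def)

lemma mpderiv_sum: "mpderiv j (sum f S) = (\<Sum>x\<in>S. mpderiv j (f x))"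
  by (induction S rule: infinite_finite_induct) (simp_all add: mpderiv_add)

lemma mpderiv_msubst:
  "mpderiv j (msubst Y p) = (\<Sum>k\<in>UNIV. msubst Y (mpderiv k p) * mpderiv j (Y k))"
proof (induction p rule: mpoly_induct)
  case (var i)
  have "(\<Sum>k\<in>UNIV. msubst Y (mpderiv k (mvar i)) * mpderiv j (Y k))
      = (\<Sum>k\<in>UNIV. if k = i then mpderiv j (Y k) else 0)"
    by (rule sum.cong) (auto simp: mpderiv_mvar)
  then show ?case by simp
next
  case (mult p q)
  then show ?case
    by (simp add: msubst_mult mpderiv_mult msubst_add sum.distrib sum_distrib_left
        sum_distrib_right algebra_simps)
qed (simp_all add: msubst_add mpderiv_add algebra_simps sum.distrib)

section \<open>Total degree and Euler's identity\<close>

definition mdeg :: "('n::finite \<Rightarrow>\<^sub>0 nat) \<Rightarrow> nat"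
  where "mdeg m = (\<Sum>k\<in>UNIV. lookup m k)"

lemma mdeg_0 [simp]: "mdeg 0 = 0"
  by (simp add: mdeg_def)

lemma mdeg_add: "mdeg (a + b) = mdeg a + mdeg b"
  by (simp add: mdeg_def lookup_add sum.distrib)

lemma mdeg_single [simp]: "mdeg (single j n) = n"
  by (simp add: mdeg_def lookup_single when_def)

lemma mdeg_diff_le: "mdeg (a - b) \<le> mdeg a"
  unfolding mdeg_def by (rule sum_mono) (simp add: lookup_minus)

lemma single_1_add_diff:
  assumes "lookup m j \<noteq> 0"
  shows "single j 1 + (m - single j 1) = (m :: 'n \<Rightarrow>\<^sub>0 nat)"
  using assms by (intro poly_mapping_eqI) (auto simp: lookup_add lookup_minus lookup_single when_def)

lemma mvar_mult_mpderiv_single: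
  "mvar k * mpderiv k (single m c) = of_nat (lookup m k) * single m c"
proof (cases "lookup m k = 0")
  case False
  then show ?thesis
    by (simp add: mpderiv_single mvar_mult_single single_1_add_diff[unfolded One_nat_def]
        mconst_mult_single flip: mconst_of_nat)
qed (simp add: mpderiv_single)

lemma euler_single:
  "(\<Sum>k\<in>UNIV. mvar k * mpderiv k (single m c)) = of_nat (mdeg m) * single m c"
  by (simp add: mvar_mult_mpderiv_single mdeg_def sum_distrib_right)

subsection \<open>Uniqueness of the normalised functional\<close>

definition rsq :: "('n::finite, 'r::comm_ring_1) mpoly"
  where "rsq = (\<Sum>j\<in>UNIV. mvar j ^ 2)"

lemma M_op_self [simp]: "M_op j j p = 0"
  by (simp add: M_op_def)

lemma M_op_mult: "M_op j k (p * q) = M_op j k p * q + p * M_op j k q"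
  by (simp add: M_op_def mpderiv_mult algebra_simps)

lemma mpderiv_rsq: "mpderiv j rsq = 2 * mvar j"
proof -
  have "mpderiv j (rsq :: ('a, 'b) mpoly) = (\<Sum>k\<in>UNIV. if k = j then 2 * mvar k else 0)"
    unfolding rsq_def mpderiv_sum
    by (rule sum.cong) (auto simp: power2_eq_square mpderiv_mult mpderiv_mvar)
  then show ?thesis by simp
qed

text \<open>The two terms \<open>2 X\<^sub>j X\<^sub>k\<close> cancel, so the rotation generator
  \<open>M_op j k\<close> annihilates \<open>rsq\<close>; the product rule extends this to
  powers.\<close>

lemma M_op_rsq_power [simp]: "M_op j k (rsq ^ n :: ('n::finite, 'r::comm_ring_1) mpoly) = 0"
proof (induction n)
  case (Suc n)
  have "M_op j k (rsq :: ('n, 'r) mpoly) = 0" by (simp add: M_op_def mpderiv_rsq algebra_simps)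
  with Suc show ?case by (simp add: M_op_mult)
qed (simp add: M_op_def)

text \<open>The diagonal term \<open>k = j\<close> is zero, which turns the coefficient
  \<open>N\<close> into \<open>N - 1\<close>. The inner sum is left for Euler's identity to evaluate
  on monomials.\<close>

lemma sum_M_op_mvar_mult:
  fixes q :: "('n::finite, 'r::comm_ring_1) mpoly"
  shows "(\<Sum>k\<in>UNIV. M_op j k (mvar k * q)) =
    of_nat (CARD('n) - 1) * (mvar j * q) + mvar j * (\<Sum>k\<in>UNIV. mvar k * mpderiv k q)
    - rsq * mpderiv j q"
proof -
  have "M_op j k (mvar k * q) = mvar j * q + mvar j * (mvar k * mpderiv k q)
      - (if k = j then mvar k * q else 0) - mvar k ^ 2 * mpderiv j q" for k
    by (simp add: M_op_def mpderiv_mult mpderiv_mvar power2_eq_square algebra_simps)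
  then have "(\<Sum>k\<in>UNIV. M_op j k (mvar k * q)) = of_nat CARD('n) * (mvar j * q)
      + mvar j * (\<Sum>k\<in>UNIV. mvar k * mpderiv k q) - mvar j * q - rsq * mpderiv j q"
    by (simp add: sum.distrib sum_subtractf sum_distrib_left sum_distrib_right rsq_def)
  then show ?thesis
    by (simp add: of_nat_diff algebra_simps)
qed

lemma is_lambda0_linear:
  assumes "is_lambda0 L"
  shows "L (p + q) = L p + L q" and "L (mconst c * p) = c * L p"
proof -
  have L: "module_hom mscale (*) L" using assms by (simp add: is_lambda0_def)
  show "L (p + q) = L p + L q" by (rule module_hom.add[OF L])
  show "L (mconst c * p) = c * L p" using module_hom.scale[OF L, of c p] by (simp add: mscale_def)
qed

lemma is_lambda0_diff: "is_lambda0 L \<Longrightarrow> L (p - q) = L p - L q"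
  using is_lambda0_linear(1)[of L "p - q" q] by simp

lemma is_lambda0_0: "is_lambda0 L \<Longrightarrow> L 0 = 0"
  using is_lambda0_diff[of L 0 0] by simp

lemma is_lambda0_sum: "is_lambda0 L \<Longrightarrow> L (sum f S) = (\<Sum>x\<in>S. L (f x))"
  by (induction S rule: infinite_finite_induct) (simp_all add: is_lambda0_linear is_lambda0_0)

text \<open>Allowing \<open>j = k\<close> lets sums over all pairs of indices be treated
  uniformly.\<close>

lemma is_lambda0_M_op: "is_lambda0 L \<Longrightarrow> L (M_op j k p) = 0"
  by (cases "j = k") (simp_all add: is_lambda0_def is_lambda0_0)

lemma is_lambda0_rsq_power: "is_lambda0 L \<Longrightarrow> L (rsq ^ n) = 1"
  by (simp add: is_lambda0_def rsq_def)

text \<open>From left to right the degree outside the power of \<open>rsq\<close> drops by two, at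
  the price of one more factor \<open>rsq\<close>.\<close>

lemma is_lambda0_recursion:
  fixes L :: "('n::finite, 'r::comm_ring_1) mpoly \<Rightarrow> 'r"
  assumes "is_lambda0 L"
  shows "of_nat (CARD('n) - 1 + mdeg m) * L (rsq ^ n * (mvar j * single m 1))
    = L (rsq ^ Suc n * mpderiv j (single m 1))"
proof -
  \<comment> \<open>\<open>M_op j k\<close> is a derivation that annihilates \<open>rsq ^ n\<close>,
    so this factor passes through it.\<close>
  have "rsq ^ n * M_op j k q = M_op j k (rsq ^ n * q)" for k and q :: "('n, 'r) mpoly"
    by (simp add: M_op_mult[of j k "rsq ^ n"])
  then have "L (\<Sum>k\<in>UNIV. rsq ^ n * M_op j k (mvar k * single m 1)) = 0"
    by (simp add: is_lambda0_sum[OF assms] is_lambda0_M_op[OF assms])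
  also have "(\<Sum>k\<in>UNIV. rsq ^ n * M_op j k (mvar k * single m 1))
      = mconst (of_nat (CARD('n) - 1 + mdeg m)) * (rsq ^ n * (mvar j * single m 1))
        - rsq ^ Suc n * mpderiv j (single m 1)"
    unfolding sum_distrib_left[symmetric] sum_M_op_mvar_mult euler_single mconst_of_nat
    unfolding of_nat_add by (simp add: algebra_simps del: of_nat_diff)
  finally show ?thesis
    by (simp add: is_lambda0_diff[OF assms] is_lambda0_linear[OF assms])
qed


section \<open>Cancelling positive integers in the coefficient ring\<close>

lemma contains_ratE:
  assumes "contains_rat TYPE('r::comm_ring_1)"
  obtains \<iota> :: "rat \<Rightarrow> 'r::comm_ring_1" where "\<And>x y. \<iota> (x + y) = \<iota> x + \<iota> y" "\<And>x y. \<iota> (x * y) = \<iota> x * \<iota> y"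
    "\<And>n. \<iota> (of_nat n) = of_nat n"
proof -
  from assms obtain \<iota> :: "rat \<Rightarrow> 'r" where \<iota>: "\<iota> 1 = 1"
    "\<And>x y. \<iota> (x + y) = \<iota> x + \<iota> y" "\<And>x y. \<iota> (x * y) = \<iota> x * \<iota> y"
    unfolding contains_rat_def by blast
  have "\<iota> 0 = 0" using \<iota>(2)[of 0 0] by simp
  then have "\<iota> (of_nat n) = of_nat n" for n
    by (induction n) (simp_all add: \<iota>)
  then show thesis by (rule that[OF \<iota>(2,3)])
qed

text \<open>The image of \<open>1 / n\<close> inverts \<open>of_nat n\<close>, even if the ring has
  zero divisors.\<close>

lemma contains_rat_of_nat_cancel:
  fixes x y :: "'r::comm_ring_1"
  assumes "contains_rat TYPE('r)" and "n > 0" and "of_nat n * x = of_nat n * y"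
  shows "x = y"
proof -
  obtain \<iota> :: "rat \<Rightarrow> 'r" where \<iota>: "\<And>x y. \<iota> (x + y) = \<iota> x + \<iota> y" "\<And>x y. \<iota> (x * y) = \<iota> x * \<iota> y"
    "\<And>n. \<iota> (of_nat n) = of_nat n"
    by (rule contains_ratE[OF assms(1)], rule that)
  have "\<iota> (inverse (of_nat n)) * of_nat n = \<iota> (inverse (of_nat n) * of_nat n)"
    by (simp only: \<iota>(2,3))
  also have "inverse (of_nat n) * of_nat n = (of_nat 1 :: rat)"
    using \<open>n > 0\<close> by simp
  also have "\<iota> (of_nat 1) = 1"
    unfolding \<iota>(3) by simp
  finally have inv: "\<iota> (inverse (of_nat n)) * of_nat n = 1" .
  have "x = \<iota> (inverse (of_nat n)) * (of_nat n * x)" by (simp flip: mult.assoc add: inv)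
  also have "\<dots> = y" unfolding assms(3) by (simp flip: mult.assoc add: inv)
  finally show ?thesis .
qed

lemma is_lambda0_unique:
  fixes L L' :: "('n::finite, 'r::comm_ring_1) mpoly \<Rightarrow> 'r"
  assumes rat: "contains_rat TYPE('r)" and card: "CARD('n) \<ge> 2"
    and L: "is_lambda0 L" and L': "is_lambda0 L'"
  shows "L = L'"
proof -
  have eq: "L (rsq ^ n * single m 1) = L' (rsq ^ n * single m 1)" for m n
  \<comment> \<open>The power \<open>n\<close> stays arbitrary because the recursion raises it while
    lowering the degree.\<close>
  proof (induction "mdeg m" arbitrary: m n rule: less_induct)
    case less
    show ?case
    proof (cases "m = 0")
      case True
      then show ?thesis by (simp add: is_lambda0_rsq_power L L')
    next
      case False
      then obtain j where j: "lookup m j \<noteq> 0"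
        by (metis lookup_zero poly_mapping_eqI)
      define l where "l = m - single j 1"
      have m: "m = single j 1 + l"
        unfolding l_def using single_1_add_diff[OF j] by simp
      \<comment> \<open>If \<open>X\<^sub>j\<close> does not occur in \<open>l\<close>, truncation
        leaves \<open>l\<close> unchanged, and its degree is still below that of
        \<open>m\<close>.\<close>
      have "mdeg (l - single j 1) < mdeg m"
        using mdeg_diff_le[of l "single j 1"] by (simp add: m mdeg_add)
      from less[OF this]
      have "L (mconst c * (rsq ^ Suc n * single (l - single j 1) 1))
          = L' (mconst c * (rsq ^ Suc n * single (l - single j 1) 1))" for c
        by (simp only: is_lambda0_linear[OF L] is_lambda0_linear[OF L'])
      moreover have "rsq ^ Suc n * mpderiv j (single l (1::'r))
          = mconst (of_nat (lookup l j)) * (rsq ^ Suc n * single (l - single j 1) 1)"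
        by (simp only: mpderiv_single mconst_mult_single mult.left_commute[of "mconst _"])
      ultimately have "L (rsq ^ Suc n * mpderiv j (single l 1)) = L' (rsq ^ Suc n * mpderiv j (single l 1))"
        by simp
      \<comment> \<open>With at least two variables \<open>CARD('n) - 1 + mdeg l\<close> is positive
        even for \<open>l = 0\<close>, so it can be cancelled.\<close>
      then have "L (rsq ^ n * (mvar j * single l 1)) = L' (rsq ^ n * (mvar j * single l 1))"
        unfolding is_lambda0_recursion[OF L, symmetric] is_lambda0_recursion[OF L', symmetric]
        by (rule contains_rat_of_nat_cancel[OF rat, rotated]) (use card in simp)
      then show ?thesis by (simp add: mvar_mult_single m)
    qed
  qed
  have "L p = L' p" for p
  proof (induction p rule: poly_mapping_induct_single)
    case (single m c)
    show ?case
      using eq[of 0 m]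
      by (simp add: single_eq_mconst_mult[of m c] is_lambda0_linear[OF L] is_lambda0_linear[OF L'])
  qed (simp add: is_lambda0_linear[OF L] is_lambda0_linear[OF L'])
  then show ?thesis by blast
qed

subsection \<open>Existence of the normalised functional\<close>

text \<open>
  A Gaussian vector is the product of independent radial and spherical parts, so spherical
  moments are quotients of Gaussian moments. In odd total degree the denominator is irrelevant,
  because some exponent is odd.
\<close>

fun gauss_moment :: "nat \<Rightarrow> rat"
  where
    "gauss_moment 0 = 1"
  | "gauss_moment (Suc 0) = 0"
  | "gauss_moment (Suc (Suc n)) = of_nat (Suc n) * gauss_moment n"

text \<open>For even \<open>n\<close> this is the expected \<open>n\<close>-th power of the norm of
  a standard Gaussian vector in dimension \<open>N\<close>. The value at 1 is a nonzero
  placeholder.\<close>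

fun radial_moment :: "nat \<Rightarrow> nat \<Rightarrow> rat"
  where
    "radial_moment N 0 = 1"
  | "radial_moment N (Suc 0) = 1"
  | "radial_moment N (Suc (Suc n)) = of_nat (N + n) * radial_moment N n"

definition sphere_moment :: "('n::finite \<Rightarrow>\<^sub>0 nat) \<Rightarrow> rat"
  where "sphere_moment m =
    (\<Prod>k\<in>UNIV. gauss_moment (lookup m k)) / radial_moment CARD('n) (mdeg m)"

text \<open>The moments are rational; \<open>\<iota>\<close> carries them into the coefficient
  ring.\<close>

definition sphere_mean :: "(rat \<Rightarrow> 'r) \<Rightarrow> ('n::finite, 'r::comm_ring_1) mpoly \<Rightarrow> 'r"
  where "sphere_mean \<iota> p = (\<Sum>m\<in>keys p. lookup p m * \<iota> (sphere_moment m))"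

text \<open>Gaussian integration by parts; for \<open>n = 0\<close> both sides are 0.\<close>

lemma of_nat_mult_gauss_moment: "of_nat n * gauss_moment (n - 1) = gauss_moment (Suc n)"
  by (cases n) simp_all

text \<open>The left side is the mean of \<open>X\<^sub>j \<partial>\<^sub>k\<close> applied to the
  monomial \<open>m\<close>. The right side is symmetric in \<open>j\<close> and \<open>k\<close>,
  so the two halves of \<open>M_op j k\<close> have equal means.\<close>

lemma sphere_moment_exchange:
  fixes m :: "'n::finite \<Rightarrow>\<^sub>0 nat"
  assumes "j \<noteq> k"
  shows "of_nat (lookup m k) * sphere_moment (single j 1 + (m - single k 1))
    = gauss_moment (Suc (lookup m j)) * gauss_moment (Suc (lookup m k))
      * (\<Prod>i\<in>UNIV - {j, k}. gauss_moment (lookup m i)) / radial_moment CARD('n) (mdeg m)"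
\<comment> \<open>If \<open>X\<^sub>k\<close> does not occur in \<open>m\<close>, the right side
  vanishes through \<open>gauss_moment (Suc 0) = 0\<close>.\<close>
proof (cases "lookup m k = 0")
  case False
  let ?l = "single j 1 + (m - single k 1)"
  have "mdeg ?l = mdeg m"
    using arg_cong[OF single_1_add_diff[OF False], of mdeg] by (simp add: mdeg_add)
  moreover have "(\<Prod>i\<in>UNIV. gauss_moment (lookup ?l i)) = gauss_moment (Suc (lookup m j))
      * gauss_moment (lookup m k - 1) * (\<Prod>i\<in>UNIV - {j, k}. gauss_moment (lookup m i))"
  proof -
    have "(UNIV :: 'n set) = insert j (insert k (UNIV - {j, k}))" by auto
    then have "(\<Prod>i\<in>UNIV. gauss_moment (lookup ?l i)) = gauss_moment (lookup ?l j)
        * (gauss_moment (lookup ?l k) * (\<Prod>i\<in>UNIV - {j, k}. gauss_moment (lookup ?l i)))"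
      using assms by (metis (no_types, lifting) Diff_iff finite finite_insert insertE insertI1
          insertI2 prod.insert)
    also have "(\<Prod>i\<in>UNIV - {j, k}. gauss_moment (lookup ?l i))
        = (\<Prod>i\<in>UNIV - {j, k}. gauss_moment (lookup m i))"
      by (rule prod.cong) (auto simp: lookup_add lookup_minus lookup_single when_def)
    finally show ?thesis
      using assms by (simp add: lookup_add lookup_minus lookup_single when_def)
  qed
  ultimately show ?thesis
    by (simp add: sphere_moment_def of_nat_mult_gauss_moment[symmetric, of "lookup m k"])
qed simp

text \<open>This reflects that \<open>rsq\<close> is 1 on the sphere. Raising the exponent
  \<open>m\<^sub>j\<close> by 2 multiplies the numerator by \<open>m\<^sub>j + 1\<close> and the
  denominator by \<open>N + mdeg m\<close>, and the numbers \<open>m\<^sub>j + 1\<close> add up to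
  \<open>N + mdeg m\<close>.\<close>

lemma sum_sphere_moment_raise:
  fixes m :: "'n::finite \<Rightarrow>\<^sub>0 nat"
  shows "(\<Sum>j\<in>UNIV. sphere_moment (single j 2 + m)) = sphere_moment m"
proof -
  let ?N = "CARD('n)"
  have "(\<Prod>i\<in>UNIV. gauss_moment (lookup (single j 2 + m) i))
      = of_nat (Suc (lookup m j)) * (\<Prod>i\<in>UNIV. gauss_moment (lookup m i))" for j
  proof -
    have "(\<Prod>i\<in>UNIV - {j}. gauss_moment (lookup (single j 2 + m) i))
        = (\<Prod>i\<in>UNIV - {j}. gauss_moment (lookup m i))"
      by (rule prod.cong) (auto simp: lookup_add lookup_single when_def)
    then show ?thesis
      by (simp add: prod.remove[of UNIV j] lookup_add)
  qed
  then have "sphere_moment (single j 2 + m)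
      = of_nat (Suc (lookup m j)) * (sphere_moment m / of_nat (?N + mdeg m))" for j
    by (simp add: sphere_moment_def mdeg_add field_simps del: of_nat_Suc of_nat_add)
  then have "(\<Sum>j\<in>UNIV. sphere_moment (single j 2 + m))
      = of_nat (\<Sum>j\<in>UNIV. Suc (lookup m j)) * (sphere_moment m / of_nat (?N + mdeg m))"
    by (simp only: of_nat_sum sum_distrib_right)
  also have "(\<Sum>j\<in>UNIV. Suc (lookup m j)) = ?N + mdeg m"
    by (simp add: mdeg_def sum_Suc)
  finally show ?thesis by (simp del: of_nat_add)
qed

lemma sphere_mean_single: "sphere_mean \<iota> (single m c) = c * \<iota> (sphere_moment m)"
  by (simp add: sphere_mean_def)

lemma sphere_mean_add: "sphere_mean \<iota> (p + q) = sphere_mean \<iota> p + sphere_mean \<iota> q"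
  unfolding sphere_mean_def by (rule setsum_keys_plus_distrib) (simp_all add: distrib_right)

lemma sphere_mean_mconst_mult: "sphere_mean \<iota> (mconst c * p) = c * sphere_mean \<iota> p"
  by (induction p rule: poly_mapping_induct_single)
    (simp_all add: mconst_mult_single sphere_mean_single sphere_mean_add algebra_simps)

lemma sphere_mean_diff: "sphere_mean \<iota> (p - q) = sphere_mean \<iota> p - sphere_mean \<iota> q"
  using sphere_mean_add[of \<iota> "p - q" q] by simp

lemma sphere_mean_sum: "sphere_mean \<iota> (sum f S) = (\<Sum>x\<in>S. sphere_mean \<iota> (f x))"
proof -
  have "sphere_mean \<iota> 0 = 0" by (simp add: sphere_mean_def)
  then show ?thesis
    by (induction S rule: infinite_finite_induct) (simp_all add: sphere_mean_add)
qed

lemma module_mscale: "module (mscale :: 'r::comm_ring_1 \<Rightarrow> ('n, 'r) mpoly \<Rightarrow> _)"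
  by standard (simp_all add: mscale_def mconst_add mconst_mult algebra_simps)

lemma module_mult: "module ((*) :: 'r::comm_ring_1 \<Rightarrow> 'r \<Rightarrow> 'r)"
  by standard (simp_all add: algebra_simps)

lemma is_lambda0_sphere_mean:
  fixes \<iota> :: "rat \<Rightarrow> 'r::comm_ring_1"
  assumes add: "\<And>x y. \<iota> (x + y) = \<iota> x + \<iota> y" and mult: "\<And>x y. \<iota> (x * y) = \<iota> x * \<iota> y"
    and of_nat: "\<And>n. \<iota> (of_nat n) = of_nat n"
  shows "is_lambda0 (sphere_mean \<iota> :: ('n::finite, 'r) mpoly \<Rightarrow> 'r)"
proof -
  have \<iota>_0: "\<iota> 0 = 0" and \<iota>_1: "\<iota> 1 = 1" using of_nat[of 0] of_nat[of 1] by simp_all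
  have \<iota>_sum: "\<iota> (sum f S) = (\<Sum>x\<in>S. \<iota> (f x))" for f :: "'n \<Rightarrow> rat" and S
    by (induction S rule: infinite_finite_induct) (simp_all add: \<iota>_0 add)
  have M: "sphere_mean \<iota> (M_op j k p) = 0" if "j \<noteq> k" for j k and p :: "('n, 'r) mpoly"
  proof (induction p rule: poly_mapping_induct_single)
    case (single m c)
    have mean: "sphere_mean \<iota> (mvar j * mpderiv k (single m c))
        = c * \<iota> (of_nat (lookup m k) * sphere_moment (single j 1 + (m - single k 1)))" for j k :: 'n
      by (simp add: mpderiv_single mvar_mult_single sphere_mean_single mult of_nat)
    show ?case
      unfolding M_op_def sphere_mean_diff mean sphere_moment_exchange[OF that]
        sphere_moment_exchange[OF that[symmetric]]
      by (simp add: mult.commute insert_commute)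
  next
    case (add p q)
    have "M_op j k (p + q) = M_op j k p + M_op j k q"
      by (simp add: M_op_def mpderiv_add algebra_simps)
    with add show ?case by (simp add: sphere_mean_add)
  qed
  have "sphere_mean \<iota> (rsq * p) = sphere_mean \<iota> p" for p :: "('n, 'r) mpoly"
  proof (induction p rule: poly_mapping_induct_single)
    case (single m c)
    have "rsq * single m c = (\<Sum>j\<in>UNIV. single (single j 2 + m) c)"
      by (simp add: rsq_def sum_distrib_right mvar_power mult_single)
    then show ?case
      by (simp add: sphere_mean_sum sphere_mean_single sum_sphere_moment_raise
          flip: sum_distrib_left \<iota>_sum)
  qed (simp add: distrib_left sphere_mean_add)
  \<comment> \<open>Removing one factor \<open>rsq\<close> at a time reduces every power to the
    constant 1.\<close>
  then have "sphere_mean \<iota> (rsq ^ n :: ('n, 'r) mpoly) = sphere_mean \<iota> (1 :: ('n, 'r) mpoly)" for n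
    by (induction n) simp_all
  also have "sphere_mean \<iota> (1 :: ('n, 'r) mpoly) = 1"
    using sphere_mean_single[of \<iota> "0 :: 'n \<Rightarrow>\<^sub>0 nat" 1] by (simp add: sphere_moment_def \<iota>_1)
  finally have "sphere_mean \<iota> (rsq ^ n :: ('n, 'r) mpoly) = 1" for n .
  moreover have "module_hom mscale (*) (sphere_mean \<iota> :: ('n, 'r) mpoly \<Rightarrow> 'r)"
    by (intro module_hom.intro module_mscale module_mult module_hom_axioms.intro)
      (simp_all add: sphere_mean_add mscale_def sphere_mean_mconst_mult)
  ultimately show ?thesis
    using M by (simp add: is_lambda0_def rsq_def)
qed

text \<open>Existence and uniqueness together make the definite description proper.\<close>

lemma is_lambda0_lambda0:
  assumes "contains_rat TYPE('r::comm_ring_1)" and "CARD('n::finite) \<ge> 2"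
  shows "is_lambda0 (lambda0 :: ('n::finite, 'r::comm_ring_1) mpoly \<Rightarrow> 'r)"
proof -
  obtain \<iota> :: "rat \<Rightarrow> 'r" where "\<And>x y. \<iota> (x + y) = \<iota> x + \<iota> y" "\<And>x y. \<iota> (x * y) = \<iota> x * \<iota> y"
    "\<And>n. \<iota> (of_nat n) = of_nat n"
    by (rule contains_ratE[OF assms(1)], rule that)
  then have mean: "is_lambda0 (sphere_mean \<iota> :: ('n, 'r) mpoly \<Rightarrow> 'r)"
    by (rule is_lambda0_sphere_mean)
  show ?thesis
    unfolding lambda0_def by (rule theI[where P = is_lambda0, OF mean]) (rule is_lambda0_unique[OF assms _ mean])
qed

subsection \<open>Orthogonal substitutions\<close>

lemma det_replace_row:
  fixes A :: "'r::comm_ring_1 ^ 'n ^ 'n"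
  shows "det (\<chi> k. if k = j then row l A else row k A) = (if l = j then det A else 0)"
proof (cases "l = j")
  case True
  then have "(\<chi> k. if k = j then row l A else row k A) = A"
    by (simp add: vec_eq_iff row_def)
  with True show ?thesis by simp
next
  case False
  then show ?thesis
    by (simp, intro det_identical_rows[OF False]) (simp add: vec_eq_iff row_def)
qed

lemma exists_adjugate:
  fixes A :: "'r::comm_ring_1 ^ 'n ^ 'n"
  obtains B where "A ** B = mat (det A)"
proof
  \<comment> \<open>Laplace expansion in disguise: row \<open>j\<close> is replaced by the \<open>i\<close>-th unit vector.\<close>
  let ?B = "\<chi> i j. det (\<chi> k. if k = j then axis i 1 else row k A)"
  have "(\<Sum>i\<in>UNIV. A $ l $ i * ?B $ i $ j) = (if l = j then det A else 0)" for l j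
  proof -
    have "(\<Sum>i\<in>UNIV. A $ l $ i * ?B $ i $ j)
        = det (\<chi> k. if k = j then (\<Sum>i\<in>UNIV. A $ l $ i *s axis i 1) else row k A)"
      by (simp add: det_linear_row_sum det_row_mul)
    also have "(\<Sum>i\<in>UNIV. A $ l $ i *s axis i 1) = row l A"
      by (simp add: vec_eq_iff row_def axis_def if_distrib cong: if_cong)
    finally show ?thesis by (simp add: det_replace_row)
  qed
  then show "A ** ?B = mat (det A)"
    by (simp add: vec_eq_iff matrix_matrix_mult_def mat_def)
qed

text \<open>\<open>det B\<close> inverts \<open>det A\<close>, so scaling the adjugate of
  \<open>A\<close> by it yields a right inverse \<open>D\<close>; a left and a right inverse of the
  same matrix coincide.\<close>

lemma matrix_left_inverse_is_right:
  fixes A B :: "'r::comm_ring_1 ^ 'n ^ 'n"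
  assumes "B ** A = mat 1"
  shows "A ** B = mat 1"
proof -
  obtain C where C: "A ** C = mat (det A)" by (rule exists_adjugate)
  have d: "det B * det A = 1" using arg_cong[OF assms, of det] by (simp add: det_mul)
  define D where "D = C ** mat (det B)"
  have "A ** D = mat (det A) ** mat (det B)"
    by (simp add: D_def C matrix_mul_assoc)
  also have "\<dots> = mat (det B * det A)"
    by (simp add: vec_eq_iff matrix_matrix_mult_def mat_def mult_delta_left mult.commute)
  finally have D: "A ** D = mat 1" by (simp only: d)
  have "B = B ** (A ** D)" by (simp add: D)
  also have "\<dots> = D" by (simp add: matrix_mul_assoc assms)
  finally show ?thesis using D by simp
qed

section \<open>Behaviour of \<open>rsq\<close> and \<open>M_op\<close> under substitution\<close>

lemma mpderiv_XA: "mpderiv j (XA A k) = mconst (A $ j $ k)"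
proof -
  have "mpderiv j (XA A k) = (\<Sum>m\<in>UNIV. if m = j then mconst (A $ m $ k) else 0)"
    unfolding XA_def mpderiv_sum
    by (rule sum.cong) (auto simp: mpderiv_mult mpderiv_mvar)
  then show ?thesis by simp
qed

text \<open>The coefficient of \<open>X\<^sub>l X\<^sub>m\<close> collects a sum over
  \<open>k\<close>, the inner product of rows \<open>l\<close> and \<open>m\<close> of
  \<open>A\<close>; hence the hypothesis on the rows.\<close>

lemma msubst_XA_rsq:
  fixes A :: "'r::comm_ring_1 ^ 'n ^ 'n"
  assumes "A ** transpose A = mat 1"
  shows "msubst (XA A) rsq = rsq"
proof -
  have orth: "(\<Sum>k\<in>UNIV. A $ l $ k * A $ m $ k) = (if l = m then 1 else 0)" for l m
    using arg_cong[OF assms, of "\<lambda>B. B $ l $ m"]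
    by (simp add: matrix_matrix_mult_def transpose_def mat_def)
  have "msubst (XA A) rsq = (\<Sum>k\<in>UNIV. \<Sum>l\<in>UNIV. \<Sum>m\<in>UNIV.
      mvar l * mvar m * mconst (A $ l $ k * A $ m $ k))"
    by (simp add: rsq_def msubst_sum msubst_mult power2_eq_square XA_def sum_product mconst_mult
        mult_ac)
  also have "\<dots> = (\<Sum>l\<in>UNIV. \<Sum>m\<in>UNIV. \<Sum>k\<in>UNIV. mvar l * mvar m * mconst (A $ l $ k * A $ m $ k))"
    by (rule trans[OF sum.swap], rule sum.cong[OF refl], rule sum.swap)
  also have "\<dots> = (\<Sum>l\<in>UNIV. \<Sum>m\<in>UNIV. mvar l * mvar m * mconst (if l = m then 1 else 0))"
    by (simp only: orth flip: sum_distrib_left mconst_sum)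
  also have "\<dots> = rsq"
    by (simp add: rsq_def power2_eq_square if_distrib cong: if_cong)
  finally show ?thesis .
qed

text \<open>The chain rule has the constant Jacobian \<open>A\<close>; orthonormality of the columns
  inverts it.\<close>

lemma msubst_XA_mpderiv:
  fixes A :: "'r::comm_ring_1 ^ 'n ^ 'n"
  assumes "transpose A ** A = mat 1"
  shows "msubst (XA A) (mpderiv k p) = (\<Sum>m\<in>UNIV. mconst (A $ m $ k) * mpderiv m (msubst (XA A) p))"
proof -
  have orth: "(\<Sum>m\<in>UNIV. A $ m $ k * A $ m $ i) = (if k = i then 1 else 0)" for i
    using arg_cong[OF assms, of "\<lambda>B. B $ k $ i"]
    by (simp add: matrix_matrix_mult_def transpose_def mat_def)
  have "(\<Sum>m\<in>UNIV. mconst (A $ m $ k) * mpderiv m (msubst (XA A) p))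
      = (\<Sum>m\<in>UNIV. \<Sum>i\<in>UNIV. msubst (XA A) (mpderiv i p) * mconst (A $ m $ k * A $ m $ i))"
    by (simp add: mpderiv_msubst mpderiv_XA sum_distrib_left mconst_mult mult_ac)
  also have "\<dots> = (\<Sum>i\<in>UNIV. msubst (XA A) (mpderiv i p) * mconst (if k = i then 1 else 0))"
    by (subst sum.swap) (simp only: orth flip: sum_distrib_left mconst_sum)
  also have "\<dots> = msubst (XA A) (mpderiv k p)"
    by (simp add: if_distrib cong: if_cong)
  finally show ?thesis by simp
qed

text \<open>Variables and derivatives transform with the same column entries of
  \<open>A\<close>.\<close>

lemma msubst_XA_M_op:
  fixes A :: "'r::comm_ring_1 ^ 'n ^ 'n"
  assumes "transpose A ** A = mat 1"
  shows "msubst (XA A) (M_op j k p) =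
    (\<Sum>l\<in>UNIV. \<Sum>m\<in>UNIV. mconst (A $ l $ j * A $ m $ k) * M_op l m (msubst (XA A) p))"
proof -
  let ?P = "msubst (XA A) p"
  have expand: "msubst (XA A) (mvar j * mpderiv k p) =
      (\<Sum>l\<in>UNIV. \<Sum>m\<in>UNIV. mconst (A $ l $ j * A $ m $ k) * (mvar l * mpderiv m ?P))" for j k
    by (simp add: msubst_mult msubst_XA_mpderiv[OF assms])
      (simp add: XA_def sum_product mconst_mult mult_ac)
  \<comment> \<open>Exchanging the summation indices gives this half the same coefficients as the
    other one.\<close>
  have "msubst (XA A) (mvar k * mpderiv j p) =
      (\<Sum>l\<in>UNIV. \<Sum>m\<in>UNIV. mconst (A $ l $ j * A $ m $ k) * (mvar m * mpderiv l ?P))"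
    unfolding expand by (subst sum.swap) (simp add: mult.commute)
  then show ?thesis
    by (simp add: M_op_def msubst_diff expand right_diff_distrib sum_subtractf)
qed

theorem proposition4p12:
  fixes A :: "('r::comm_ring_1) ^ 'n ^ ('n::finite)"
    and p :: "('n, 'r) mpoly"
  assumes "contains_rat TYPE('r)"
    and "CARD('n) \<ge> 2"
    and "transpose A ** A = mat 1"
  shows "lambda0 (msubst (XA A) p) = lambda0 p"
proof -
  note lam = is_lambda0_lambda0[where 'n = 'n, OF assms(1,2)]
  let ?L = "\<lambda>p :: ('n, 'r) mpoly. lambda0 (msubst (XA A) p)"
  have "A ** transpose A = mat 1" by (rule matrix_left_inverse_is_right[OF assms(3)])
  then have "?L (rsq ^ n) = 1" for n
    by (simp add: msubst_power msubst_XA_rsq is_lambda0_rsq_power[OF lam])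
  moreover have "?L (M_op j k q) = 0" for j k q
    by (simp add: msubst_XA_M_op[OF assms(3)] is_lambda0_sum[OF lam] is_lambda0_linear[OF lam]
        is_lambda0_M_op[OF lam])
  moreover have "module_hom mscale (*) ?L"
    by (intro module_hom.intro module_mscale module_mult module_hom_axioms.intro)
      (simp_all add: msubst_add msubst_mult mscale_def is_lambda0_linear[OF lam])
  ultimately have "is_lambda0 ?L" by (simp add: is_lambda0_def rsq_def)
  from is_lambda0_unique[OF assms(1,2) this lam] show ?thesis by metis
qed

end
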